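(* Let $\mathcal{G}$ be a connected metric graph with vertex set $\mathsf{V}$ and edge set $\mathsf{E}$, and let $\alpha\in[0,\infty)^{\mathsf{V}}$ be not identically zero. Write $|\alpha|_1=\sum_{\mathsf{v}\in\mathsf{V}}\alpha_{\mathsf{v}}$. Then $$T(\mathcal{G},\alpha)\geq\frac{|\mathcal{G}|^3}{12|\mathsf{E}|^2}+\frac{|\mathcal{G}|^2}{|\alpha|_1}.$$ In particular, at fixed total length, number of edges and total strength, flower graphs (with a $\delta$-vertex condition at their only vertex) minimize the torsional rigidity.
   Context: A metric graph $\mathcal{G}$ is a finite collection of intervals glued together at their endpoints according to a finite combinatorial graph $(\mathsf{V},\mathsf{E})$ (loops and multiple edges allowed); each edge $\mathsf{e}\in\mathsf{E}$ is identified with $[0,\ell_{\mathsf{e}}]$, $\ell_{\mathsf{e}}\in(0,\infty)$. The total length is $|\mathcal{G}|=\sum_{\mathsf{e}\in\mathsf{E}}\ell_{\mathsf{e}}$, and $|\mathsf{E}|$ is the number of edges. $\mathcal{G}$ is connected if any two points are joined by a continuous path. $\mathsf{E}_{\mathsf{v}}$ is the collection of edges incident to $\mathsf{v}$ (a loop at $\mathsf{v}$ contributes once for each of its two endpoints), $u_{\mathsf{e}}$ is the restriction of $u$ to $\mathsf{e}$, and $\frac{\partial u_{\mathsf{e}}}{\partial n}(\mathsf{v})$ is the derivative of $u_{\mathsf{e}}$ at the endpoint $\mathsf{v}$ in the direction pointing into $\mathsf{v}$. For $\alpha\in\mathbb{R}^{\mathsf{V}}$ (the strengths), the operator $-\Delta_{\mathcal{G},\alpha}$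 in $L^2(\mathcal{G})$ acts as $u\mapsto -u''$ on each edge, on functions that are edgewise in $H^2(0,\ell_{\mathsf{e}})$, continuous at every vertex, and satisfy the $\delta$-vertex conditions $\sum_{\mathsf{e}\in\mathsf{E}_{\mathsf{v}}}\frac{\partial u_{\mathsf{e}}}{\partial n}(\mathsf{v})+\alpha_{\mathsf{v}}u(\mathsf{v})=0$ for all $\mathsf{v}\in\mathsf{V}$. The torsion function of $(\mathcal{G},\alpha)$ is the unique solution $\upsilon$ of $-\Delta_{\mathcal{G},\alpha}\upsilon=1$ (it exists and is strictly positive when $\mathcal{G}$ is connected and $\alpha\in[0,\infty)^{\mathsf{V}}$ is not identically zero), and the torsional rigidity is $T(\mathcal{G},\alpha)=\int_{\mathcal{G}}\upsilon(x)\,\mathrm{d}x$. The total strength is $|\alpha|_1$. A flower graph is a metric graph with exactly one vertex, all of whose edges are loops at that vertex, with edge lengths $\ell_{\mathsf{e}}\in(0,\infty)$, $\mathsf{e}\in\mathsf{E}$ (not required to be equal); it carries a $\delta$-vertex condition at its only vertex, whose strength is therefore the total strength.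
   Formalization: Read literally, the last sentence fails for unequal loops (lengths 1, 3 versus 2, 2); the formal statement says that for each total length, number of edges and total strength some flower graph attains the minimum, which equals the stated lower bound. *)

theory Defs
  imports "HOL-Analysis.Analysis" "Graph_Theory.Digraph"
begin

section \<open>Metric graphs\<close>

text \<open>
  The combinatorial graph is a finite multi-digraph with loops and parallel arcs allowed. The
  direction of an arc \<open>e\<close> carries no meaning beyond the identification of \<open>e\<close> with \<open>[0, len e]\<close>:
  \<open>0\<close> is glued to \<open>tail G e\<close> and \<open>len e\<close> to \<open>head G e\<close>.
\<close>

locale metric_graph = fin_digraph G
  for G :: "('v, 'e) pre_digraph" and len :: "'e \<Rightarrow> real" +
  assumes length_pos: "e \<in> arcs G \<Longrightarrow> 0 < len e"

definition total_length :: "('v, 'e) pre_digraph \<Rightarrow> ('e \<Rightarrow> real) \<Rightarrow> real" where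
  "total_length G len = (\<Sum>e\<in>arcs G. len e)"

text \<open>
  A point of the metric graph is a vertex \<open>Inl v\<close> or an interior point \<open>Inr (e, x)\<close>, \<open>0 < x < len e\<close>,
  of an edge; \<open>glue G len e\<close> is the canonical map from \<open>[0, len e]\<close> into the metric graph.
\<close>

definition mg_points :: "('v, 'e) pre_digraph \<Rightarrow> ('e \<Rightarrow> real) \<Rightarrow> ('v + 'e \<times> real) set" where
  "mg_points G len = Inl ` verts G \<union> {Inr (e, x) | e x. e \<in> arcs G \<and> 0 < x \<and> x < len e}"

definition glue :: "('v, 'e) pre_digraph \<Rightarrow> ('e \<Rightarrow> real) \<Rightarrow> 'e \<Rightarrow> real \<Rightarrow> 'v + 'e \<times> real" where
  "glue G len e x =
     (if x = 0 then Inl (tail G e) else if x = len e then Inl (head G e) else Inr (e, x))"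

text \<open>The quotient topology of the disjoint union of the intervals (and of the vertices).\<close>

definition mg_topology :: "('v, 'e) pre_digraph \<Rightarrow> ('e \<Rightarrow> real) \<Rightarrow> ('v + 'e \<times> real) topology" where
  "mg_topology G len = topology (\<lambda>U. U \<subseteq> mg_points G len \<and>
     (\<forall>e\<in>arcs G. openin (top_of_set {0..len e}) {x \<in> {0..len e}. glue G len e x \<in> U}))"

lemma openin_mg_topology:
  "openin (mg_topology G len) U \<longleftrightarrow> U \<subseteq> mg_points G len \<and>
     (\<forall>e\<in>arcs G. openin (top_of_set {0..len e}) {x \<in> {0..len e}. glue G len e x \<in> U})"
proof -
  let ?P = "\<lambda>U. U \<subseteq> mg_points G len \<and>
     (\<forall>e\<in>arcs G. openin (top_of_set {0..len e}) {x \<in> {0..len e}. glue G len e x \<in> U})"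
  have "?P (S \<inter> T)" if "?P S" "?P T" for S T
  proof -
    have "{x \<in> {0..len e}. glue G len e x \<in> S \<inter> T}
      = {x \<in> {0..len e}. glue G len e x \<in> S} \<inter> {x \<in> {0..len e}. glue G len e x \<in> T}" for e
      by auto
    then show ?thesis using that by (auto intro: openin_Int)
  qed
  moreover have "?P (\<Union>K)" if "\<forall>S\<in>K. ?P S" for K
  proof -
    have "{x \<in> {0..len e}. glue G len e x \<in> \<Union>K} = (\<Union>S\<in>K. {x \<in> {0..len e}. glue G len e x \<in> S})" for e
      by auto
    then show ?thesis using that by (auto intro!: openin_Union)
  qed
  ultimately have "istopology ?P"
    unfolding istopology_def by blast
  then show ?thesis
    by (simp add: mg_topology_def)
qed

lemma (in metric_graph) topspace_mg_topology: "topspace (mg_topology G len) = mg_points G len"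
proof -
  have "glue G len e x \<in> mg_points G len" if "e \<in> arcs G" "x \<in> {0..len e}" for e x
    using that by (auto simp: glue_def mg_points_def)
  then have "{x \<in> {0..len e}. glue G len e x \<in> mg_points G len} = {0..len e}" if "e \<in> arcs G" for e
    using that by blast
  then have "openin (mg_topology G len) (mg_points G len)"
    by (simp add: openin_mg_topology)
  then show ?thesis
    by (meson openin_mg_topology openin_subset openin_topspace subset_antisym)
qed

definition mg_connected :: "('v, 'e) pre_digraph \<Rightarrow> ('e \<Rightarrow> real) \<Rightarrow> bool" where
  "mg_connected G len \<longleftrightarrow> path_connected_space (mg_topology G len)"

definition mg_integral ::
    "('v, 'e) pre_digraph \<Rightarrow> ('e \<Rightarrow> real) \<Rightarrow> ('v + 'e \<times> real \<Rightarrow> real) \<Rightarrow> real" where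
  "mg_integral G len u = (\<Sum>e\<in>arcs G. LINT x|lebesgue_on {0..len e}. u (glue G len e x))"

section \<open>The Laplacian with \<open>\<delta>\<close>-vertex conditions\<close>

definition in_L2 :: "real \<Rightarrow> (real \<Rightarrow> real) \<Rightarrow> bool" where
  "in_L2 l g \<longleftrightarrow> g \<in> borel_measurable (lebesgue_on {0..l}) \<and>
     integrable (lebesgue_on {0..l}) (\<lambda>x. (g x)\<^sup>2)"

text \<open>
  \<open>H2_second_deriv l f g\<close>: \<open>f\<close> is (the \<open>C\<^sup>1[0, l]\<close> representative of) an element of \<open>H\<^sup>2(0, l)\<close>
  whose second weak derivative is the \<open>L\<^sup>2\<close>-class of \<open>g\<close>, i.e. \<open>f'\<close> is absolutely continuous on
  \<open>[0, l]\<close> with \<open>f'' = g\<close> almost everywhere and \<open>g\<close> square integrable. The relation depends on \<open>g\<close>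
  only up to null sets.
\<close>

definition H2_second_deriv :: "real \<Rightarrow> (real \<Rightarrow> real) \<Rightarrow> (real \<Rightarrow> real) \<Rightarrow> bool" where
  "H2_second_deriv l f g \<longleftrightarrow> in_L2 l g \<and>
     (\<exists>f'. \<forall>x\<in>{0..l}. (f has_real_derivative f' x) (at x within {0..l}) \<and>
                     f' x = f' 0 + (LINT t|lebesgue_on {0..x}. g t))"

definition in_H2 :: "real \<Rightarrow> (real \<Rightarrow> real) \<Rightarrow> bool" where
  "in_H2 l f \<longleftrightarrow> (\<exists>g. H2_second_deriv l f g)"

definition edge_deriv ::
    "('v, 'e) pre_digraph \<Rightarrow> ('e \<Rightarrow> real) \<Rightarrow> ('v + 'e \<times> real \<Rightarrow> real) \<Rightarrow> 'e \<Rightarrow> real \<Rightarrow> real" where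
  "edge_deriv G len u e x =
     vector_derivative (\<lambda>t. u (glue G len e t)) (at x within {0..len e})"

text \<open>
  Sum of the derivatives at \<open>v\<close> in the direction pointing into \<open>v\<close>; a loop occurs in both sums.
\<close>

definition normal_deriv_sum ::
    "('v, 'e) pre_digraph \<Rightarrow> ('e \<Rightarrow> real) \<Rightarrow> ('v + 'e \<times> real \<Rightarrow> real) \<Rightarrow> 'v \<Rightarrow> real" where
  "normal_deriv_sum G len u v =
     (\<Sum>e\<in>in_arcs G v. edge_deriv G len u e (len e)) + (\<Sum>e\<in>out_arcs G v. - edge_deriv G len u e 0)"

text \<open>
  Functions on the metric graph are represented by functions that are \<open>undefined\<close> outside of
  \<open>mg_points G len\<close>, so that they are determined by their values on the graph.
\<close>

definition delta_domain ::
    "('v, 'e) pre_digraph \<Rightarrow> ('e \<Rightarrow> real) \<Rightarrow> ('v \<Rightarrow> real) \<Rightarrow> ('v + 'e \<times> real \<Rightarrow> real) set" where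
  "delta_domain G len \<alpha> = {u \<in> extensional (mg_points G len).
     (\<forall>e\<in>arcs G. in_H2 (len e) (\<lambda>x. u (glue G len e x))) \<and>
     continuous_map (mg_topology G len) euclideanreal u \<and>
     (\<forall>v\<in>verts G. normal_deriv_sum G len u v + \<alpha> v * u (Inl v) = 0)}"

text \<open>\<open>u\<close> lies in the operator domain and \<open>- u'' = w\<close> in \<open>L\<^sup>2\<close> of the metric graph.\<close>

definition neg_laplacian_eq ::
    "('v, 'e) pre_digraph \<Rightarrow> ('e \<Rightarrow> real) \<Rightarrow> ('v \<Rightarrow> real) \<Rightarrow>
     ('v + 'e \<times> real \<Rightarrow> real) \<Rightarrow> ('v + 'e \<times> real \<Rightarrow> real) \<Rightarrow> bool" where
  "neg_laplacian_eq G len \<alpha> u w \<longleftrightarrow> u \<in> delta_domain G len \<alpha> \<and>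
     (\<forall>e\<in>arcs G. H2_second_deriv (len e) (\<lambda>x. u (glue G len e x)) (\<lambda>x. - w (glue G len e x)))"

definition torsion_function ::
    "('v, 'e) pre_digraph \<Rightarrow> ('e \<Rightarrow> real) \<Rightarrow> ('v \<Rightarrow> real) \<Rightarrow> 'v + 'e \<times> real \<Rightarrow> real" where
  "torsion_function G len \<alpha> = (THE u. neg_laplacian_eq G len \<alpha> u (\<lambda>_. 1))"

definition torsional_rigidity ::
    "('v, 'e) pre_digraph \<Rightarrow> ('e \<Rightarrow> real) \<Rightarrow> ('v \<Rightarrow> real) \<Rightarrow> real" where
  "torsional_rigidity G len \<alpha> = mg_integral G len (torsion_function G len \<alpha>)"

definition total_strength :: "('v, 'e) pre_digraph \<Rightarrow> ('v \<Rightarrow> real) \<Rightarrow> real" where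
  "total_strength G \<alpha> = (\<Sum>v\<in>verts G. \<alpha> v)"

definition admissible :: "('v, 'e) pre_digraph \<Rightarrow> ('e \<Rightarrow> real) \<Rightarrow> ('v \<Rightarrow> real) \<Rightarrow> bool" where
  "admissible G len \<alpha> \<longleftrightarrow> metric_graph G len \<and> mg_connected G len \<and>
     (\<forall>v\<in>verts G. 0 \<le> \<alpha> v) \<and> (\<exists>v\<in>verts G. \<alpha> v \<noteq> 0)"

definition admissible_with ::
    "real \<Rightarrow> nat \<Rightarrow> real \<Rightarrow> ('v, 'e) pre_digraph \<Rightarrow> ('e \<Rightarrow> real) \<Rightarrow> ('v \<Rightarrow> real) \<Rightarrow> bool" where
  "admissible_with L n s G len \<alpha> \<longleftrightarrow> admissible G len \<alpha> \<and>
     total_length G len = L \<and> card (arcs G) = n \<and> total_strength G \<alpha> = s"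

definition flower_graph :: "('v, 'e) pre_digraph \<Rightarrow> ('e \<Rightarrow> real) \<Rightarrow> bool" where
  "flower_graph G len \<longleftrightarrow> metric_graph G len \<and> (\<exists>v. verts G = {v})"

end

theory Submission
  imports Defs
begin

text \<open>
  On every edge the torsion function is the quadratic polynomial with second derivative \<open>- 1\<close> that
  interpolates its vertex values, so it amounts to a solution \<open>U\<close> of a weighted discrete Laplace
  equation on the vertices. The associated form
  \<open>Q U = (\<Sum>e. (U (head e) - U (tail e))\<^sup>2 / len e) + (\<Sum>v. \<alpha> v * (U v)\<^sup>2)\<close> is definite on a connected
  graph, and \<open>T = (\<Sum>e. len e ^ 3) / 12 + Q U\<close>. The first term is at least \<open>|G|\<^sup>3 / (12 |E|\<^sup>2)\<close> by
  convexity. Testing the equation with the constant \<open>1\<close> gives \<open>(\<Sum>v. \<alpha> v * U v) = |G|\<close>, so the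
  Cauchy-Schwarz inequality yields \<open>Q U \<ge> |G|\<^sup>2 / |\<alpha>|\<^sub>1\<close>. Both are equalities for equilateral flowers.
\<close>

section \<open>Definite linear systems and two inequalities\<close>

text \<open>Gaussian elimination, one index at a time: definiteness makes every pivot nonzero and
  passes to the Schur complement, so no determinant or rank argument is involved.\<close>

lemma definite_system_solvable:
  fixes a :: "'i \<Rightarrow> 'i \<Rightarrow> real"
  assumes "finite S"
    and "\<And>x. (\<Sum>i\<in>S. x i * (\<Sum>j\<in>S. a i j * x j)) = 0 \<Longrightarrow> \<forall>i\<in>S. x i = 0"
  shows "\<exists>x. \<forall>i\<in>S. (\<Sum>j\<in>S. a i j * x j) = b i"
  using assms
proof (induction S arbitrary: a b rule: finite_induct)
  case empty
  then show ?case by simp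
next
  case (insert k S)
  \<comment> \<open>The form takes the value \<open>a k k\<close> at the unit vector of
    \<open>k\<close>, which is not the zero vector.\<close>
  have pivot: "a k k \<noteq> 0"
  proof
    assume "a k k = 0"
    then have "(\<Sum>i\<in>insert k S. of_bool (i = k) * (\<Sum>j\<in>insert k S. a i j * of_bool (j = k))) = 0"
      using insert.hyps by (intro sum.neutral) (auto intro!: sum.neutral)
    from insert.prems[OF this] show False by simp
  qed
  \<comment> \<open>Schur complement of the pivot\<close>
  define a' where "a' i j = a i j - a i k * a k j / a k k" for i j
  have row: "(\<Sum>j\<in>S. a' i j * x j) = (\<Sum>j\<in>S. a i j * x j) - a i k * (\<Sum>j\<in>S. a k j * x j) / a k k" for i x
    by (simp add: a'_def left_diff_distrib sum_subtractf sum_distrib_left sum_divide_distrib mult.assoc)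
  have upd: "(\<Sum>j\<in>S. a i j * (if j = k then c else x j)) = (\<Sum>j\<in>S. a i j * x j)" for i x and c :: real
    using insert.hyps by (intro sum.cong) auto
  have "\<forall>i\<in>S. x i = 0" if x: "(\<Sum>i\<in>S. x i * (\<Sum>j\<in>S. a' i j * x j)) = 0" for x
  proof -
    \<comment> \<open>The \<open>k\<close>-th coordinate is chosen to make row \<open>k\<close> of
      the full system vanish. The remaining rows then reduce to \<open>a'\<close>, so the two forms
      agree.\<close>
    define y where "y = x(k := - (\<Sum>j\<in>S. a k j * x j) / a k k)"
    have yk: "(\<Sum>j\<in>insert k S. a k j * y j) = 0"
      using insert.hyps pivot by (simp add: y_def upd)
    have yi: "(\<Sum>j\<in>insert k S. a i j * y j) = (\<Sum>j\<in>S. a' i j * x j)" if "i \<in> S" for i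
      using insert.hyps unfolding row by (simp add: y_def upd)
    have "(\<Sum>i\<in>insert k S. y i * (\<Sum>j\<in>insert k S. a i j * y j))
        = (\<Sum>i\<in>S. y i * (\<Sum>j\<in>insert k S. a i j * y j))"
      using insert.hyps by (subst sum.insert) (simp_all only: yk, simp)
    also have "\<dots> = (\<Sum>i\<in>S. x i * (\<Sum>j\<in>S. a' i j * x j))"
      using insert.hyps by (intro sum.cong refl) (auto simp only: yi, auto simp: y_def)
    finally have "\<forall>i\<in>insert k S. y i = 0"
      using x by (intro insert.prems) simp
    then show ?thesis
      using insert.hyps by (auto simp: y_def split: if_splits)
  qed
  from insert.IH[OF this, where b = "\<lambda>i. b i - a i k * b k / a k k"]
  obtain x where x: "\<forall>i\<in>S. (\<Sum>j\<in>S. a' i j * x j) = b i - a i k * b k / a k k"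
    by blast
  \<comment> \<open>Back substitution: row \<open>k\<close> determines the missing
    coordinate.\<close>
  let ?y = "x(k := (b k - (\<Sum>j\<in>S. a k j * x j)) / a k k)"
  have "(\<Sum>j\<in>insert k S. a i j * ?y j) = b i" if "i \<in> insert k S" for i
  proof (cases "i = k")
    case True
    then show ?thesis
      using insert.hyps pivot by (simp add: upd)
  next
    case False
    then have "(\<Sum>j\<in>S. a i j * x j) - a i k * (\<Sum>j\<in>S. a k j * x j) / a k k = b i - a i k * b k / a k k"
      using x that unfolding row by blast
    then show ?thesis
      using insert.hyps by (simp add: upd algebra_simps diff_divide_distrib)
  qed
  then show ?case by blast
qed

text \<open>Cauchy-Schwarz for the vectors \<open>sqrt (w i)\<close> and
  \<open>sqrt (w i) * f i\<close>. If the weights sum to 0, the left side is 0 because division by 0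
  yields 0.\<close>

lemma weighted_square_sum_ge:
  fixes w f :: "'i \<Rightarrow> real"
  assumes "\<And>i. i \<in> I \<Longrightarrow> 0 \<le> w i"
  shows "(\<Sum>i\<in>I. w i * f i)\<^sup>2 / (\<Sum>i\<in>I. w i) \<le> (\<Sum>i\<in>I. w i * (f i)\<^sup>2)"
proof (cases "(\<Sum>i\<in>I. w i) = 0")
  case True
  then show ?thesis
    using assms by (auto intro!: sum_nonneg)
next
  case False
  have "(\<Sum>i\<in>I. sqrt (w i) * (sqrt (w i) * f i))\<^sup>2
      \<le> (\<Sum>i\<in>I. (sqrt (w i))\<^sup>2) * (\<Sum>i\<in>I. (sqrt (w i) * f i)\<^sup>2)"
    by (rule Cauchy_Schwarz_ineq_sum)
  then have "(\<Sum>i\<in>I. w i * f i)\<^sup>2 \<le> (\<Sum>i\<in>I. w i) * (\<Sum>i\<in>I. w i * (f i)\<^sup>2)"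
    using assms by (simp add: power_mult_distrib mult.assoc[symmetric])
  moreover have "0 < (\<Sum>i\<in>I. w i)"
    using False assms by (simp add: order_less_le sum_nonneg)
  ultimately show ?thesis
    by (simp add: divide_le_eq mult.commute)
qed

text \<open>Jensen for the cube, by its tangent at the mean \<open>m\<close>: the linear terms
  cancel in the sum. For empty \<open>I\<close> the quotient is 0 by the convention on
  division.\<close>

lemma sum_cubes_ge:
  fixes f :: "'i \<Rightarrow> real"
  assumes "finite I" "\<And>i. i \<in> I \<Longrightarrow> 0 \<le> f i"
  shows "(\<Sum>i\<in>I. f i) ^ 3 / real (card I) ^ 2 \<le> (\<Sum>i\<in>I. f i ^ 3)"
proof (cases "I = {}")
  case False
  define m where "m = (\<Sum>i\<in>I. f i) / card I"
  have n: "real (card I) > 0"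
    using False assms by (simp add: card_gt_0_iff)
  have m: "0 \<le> m"
    unfolding m_def using assms by (intro divide_nonneg_nonneg sum_nonneg) auto
  have tangent: "m ^ 3 + 3 * m\<^sup>2 * (f i - m) \<le> f i ^ 3" if "i \<in> I" for i
  proof -
    \<comment> \<open>Tangency gives a double root at \<open>m\<close>; the remaining root is
      \<open>- 2 * m\<close>, so the gap is nonnegative on the half line.\<close>
    have "f i ^ 3 - (m ^ 3 + 3 * m\<^sup>2 * (f i - m)) = (f i - m)\<^sup>2 * (f i + 2 * m)"
      by (simp add: power2_eq_square power3_eq_cube algebra_simps)
    moreover have "0 \<le> (f i - m)\<^sup>2 * (f i + 2 * m)"
      using assms(2)[OF that] m by simp
    ultimately show ?thesis by linarith
  qed
  have "(\<Sum>i\<in>I. f i) ^ 3 / real (card I) ^ 2 = card I * m ^ 3"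
    using n by (simp add: m_def field_simps power2_eq_square power3_eq_cube)
  also have "\<dots> = (\<Sum>i\<in>I. m ^ 3 + 3 * m\<^sup>2 * (f i - m))"
    using n by (simp add: sum.distrib sum_subtractf sum_distrib_left[symmetric] m_def)
  also have "\<dots> \<le> (\<Sum>i\<in>I. f i ^ 3)"
    by (intro sum_mono tangent)
  finally show ?thesis .
qed simp

section \<open>The equation on an edge\<close>

text \<open>The weak equation integrates to \<open>f' x = f' 0 - x\<close>; a second integration
  gives a quadratic whose unknown slope \<open>f' 0\<close> is eliminated through the value at
  \<open>l\<close>.\<close>

lemma H2_second_deriv_minus_one_imp:
  assumes l: "0 < l" and f: "H2_second_deriv l f (\<lambda>_. - 1)" and x: "x \<in> {0..l}"
  shows "f x = f 0 + ((f l - f 0) / l + l / 2) * x - x\<^sup>2 / 2"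
proof -
  obtain f' where f': "\<And>x. x \<in> {0..l} \<Longrightarrow> (f has_real_derivative f' x) (at x within {0..l})"
    and f'_eq: "\<And>x. x \<in> {0..l} \<Longrightarrow> f' x = f' 0 + (LINT t|lebesgue_on {0..x}. - 1)"
    using f unfolding H2_second_deriv_def by blast
  have deriv: "(f has_real_derivative f' 0 - x) (at x within {0..l})" if "x \<in> {0..l}" for x
  proof -
    have "f' x = f' 0 - x"
      using f'_eq[OF that] that by (simp add: measure_restrict_space)
    with f'[OF that] show ?thesis by simp
  qed
  have "\<exists>c. \<forall>x\<in>{0..l}. f x - (f' 0 * x - x\<^sup>2 / 2) = c"
    by (rule has_field_derivative_zero_constant)
      (auto intro!: derivative_eq_intros deriv)
  then obtain c where c: "\<And>x. x \<in> {0..l} \<Longrightarrow> f x - (f' 0 * x - x\<^sup>2 / 2) = c"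
    by blast
  have "f 0 = c" "f l = c + f' 0 * l - l\<^sup>2 / 2"
    using c[of 0] c[of l] l by auto
  then show ?thesis
    using c[OF x] l by (simp add: field_simps power2_eq_square)
qed

lemma has_derivative_quadratic_on:
  assumes "\<And>x. x \<in> {0..l} \<Longrightarrow> f x = a + b * x - x\<^sup>2 / 2" and "x \<in> {0..l}"
  shows "(f has_real_derivative b - x) (at x within {0..l :: real})"
proof -
  have "((\<lambda>x. a + b * x - x\<^sup>2 / 2) has_real_derivative b - x) (at x within {0..l})"
    by (auto intro!: derivative_eq_intros)
  then show ?thesis
    \<comment> \<open>The functions agree on the whole interval, so any positive radius
      \<open>d\<close> would do.\<close>
    by (rule has_field_derivative_transform_within[where d = 1]) (use assms in auto)
qed

lemma H2_second_deriv_quadratic: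
  assumes "\<And>x. x \<in> {0..l} \<Longrightarrow> f x = a + b * x - x\<^sup>2 / 2"
  shows "H2_second_deriv l f (\<lambda>_. - 1)"
proof -
  have "in_L2 l (\<lambda>_. - 1)"
    by (auto simp: in_L2_def intro!: continuous_imp_integrable_real)
  moreover have "\<forall>x\<in>{0..l}. (f has_real_derivative b - x) (at x within {0..l}) \<and>
      b - x = (b - 0) + (LINT t|lebesgue_on {0..x}. - 1)"
    using has_derivative_quadratic_on[of l f a b] assms by (auto simp: measure_restrict_space)
  ultimately show ?thesis
    unfolding H2_second_deriv_def by blast
qed

lemma integral_quadratic:
  fixes l :: real
  assumes "0 \<le> l" "\<And>x. x \<in> {0..l} \<Longrightarrow> f x = a + b * x - x\<^sup>2 / 2"
  shows "(LINT x|lebesgue_on {0..l}. f x) = a * l + b * l\<^sup>2 / 2 - l ^ 3 / 6"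
proof -
  have "(LINT x|lebesgue_on {0..l}. f x) = (LINT x|lebesgue_on {0..l}. a + b * x - x\<^sup>2 / 2)"
    by (rule Bochner_Integration.integral_cong) (auto simp: assms)
  also have "\<dots> = integral {0..l} (\<lambda>x. a + b * x - x\<^sup>2 / 2)"
    by (intro lebesgue_integral_eq_integral continuous_imp_integrable_real continuous_intros) auto
  also have "((\<lambda>x. a + b * x - x\<^sup>2 / 2) has_integral
      (a * l + b * l\<^sup>2 / 2 - l ^ 3 / 6) - (a * 0 + b * 0\<^sup>2 / 2 - 0 ^ 3 / 6)) {0..l}"
    using assms(1)
    by (intro fundamental_theorem_of_calculus)
      (auto intro!: derivative_eq_intros simp: has_real_derivative_iff_has_vector_derivative[symmetric])
  then have "integral {0..l} (\<lambda>x. a + b * x - x\<^sup>2 / 2) = a * l + b * l\<^sup>2 / 2 - l ^ 3 / 6"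
    by (simp add: integral_unique)
  finally show ?thesis .
qed

section \<open>Reduction to the vertices\<close>

text \<open>The linear interpolant of the end values plus \<open>x * (len e - x) / 2\<close>, the
  torsion function of the interval with Dirichlet ends.\<close>

definition edge_profile ::
    "('v, 'e) pre_digraph \<Rightarrow> ('e \<Rightarrow> real) \<Rightarrow> ('v \<Rightarrow> real) \<Rightarrow> 'e \<Rightarrow> real \<Rightarrow> real" where
  "edge_profile G len U e x =
     U (tail G e) + ((U (head G e) - U (tail G e)) / len e + len e / 2) * x - x\<^sup>2 / 2"

text \<open>The two indicators cancel for a loop, in accordance with its zero potential
  difference.\<close>

definition incidence :: "('v, 'e) pre_digraph \<Rightarrow> 'e \<Rightarrow> 'v \<Rightarrow> real" where
  "incidence G e v = of_bool (head G e = v) - of_bool (tail G e = v)"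

text \<open>The weighted graph Laplacian with conductances \<open>1 / len e\<close>, plus the
  potential \<alpha>.\<close>

definition vertex_operator ::
    "('v, 'e) pre_digraph \<Rightarrow> ('e \<Rightarrow> real) \<Rightarrow> ('v \<Rightarrow> real) \<Rightarrow> ('v \<Rightarrow> real) \<Rightarrow> 'v \<Rightarrow> real" where
  "vertex_operator G len \<alpha> U v =
     (\<Sum>e\<in>arcs G. incidence G e v * ((U (head G e) - U (tail G e)) / len e)) + \<alpha> v * U v"

text \<open>Each edge gives half of its length to each of its ends, so a loop gives all of it to one
  vertex.\<close>

definition vertex_mass :: "('v, 'e) pre_digraph \<Rightarrow> ('e \<Rightarrow> real) \<Rightarrow> 'v \<Rightarrow> real" where
  "vertex_mass G len v =
     (\<Sum>e\<in>arcs G. (of_bool (head G e = v) + of_bool (tail G e = v)) * (len e / 2))"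

definition nodal_solution ::
    "('v, 'e) pre_digraph \<Rightarrow> ('e \<Rightarrow> real) \<Rightarrow> ('v \<Rightarrow> real) \<Rightarrow> ('v \<Rightarrow> real) \<Rightarrow> bool" where
  "nodal_solution G len \<alpha> U \<longleftrightarrow> (\<forall>v\<in>verts G. vertex_operator G len \<alpha> U v = vertex_mass G len v)"

text \<open>The restriction supplies the extensionality required by
  \<open>delta_domain\<close>.\<close>

definition extend_from_vertices ::
    "('v, 'e) pre_digraph \<Rightarrow> ('e \<Rightarrow> real) \<Rightarrow> ('v \<Rightarrow> real) \<Rightarrow> 'v + 'e \<times> real \<Rightarrow> real" where
  "extend_from_vertices G len U =
     restrict (case_sum U (\<lambda>(e, x). edge_profile G len U e x)) (mg_points G len)"

context metric_graph
begin

section \<open>Discrete Green formula and equivalence with the nodal equation\<close>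

lemma glue_tail [simp]: "glue G len e 0 = Inl (tail G e)"
  by (simp add: glue_def)

lemma glue_head: "e \<in> arcs G \<Longrightarrow> glue G len e (len e) = Inl (head G e)"
  using length_pos[of e] by (simp add: glue_def)

lemma sum_incidence:
  assumes "e \<in> arcs G"
  shows "(\<Sum>v\<in>verts G. incidence G e v * W v) = W (head G e) - W (tail G e)"
proof -
  have "(\<Sum>v\<in>verts G. of_bool (w = v) * W v) = W w" if "w \<in> verts G" for w
    using that by (simp add: of_bool_def if_distribR if_distrib cong: if_cong)
  then show ?thesis
    using assms by (simp add: incidence_def left_diff_distrib sum_subtractf)
qed

text \<open>Summation by parts. It is used with \<open>W = U\<close> for the energy and with
  \<open>W = 1\<close>, where the edge terms vanish.\<close>

lemma green:
  "(\<Sum>v\<in>verts G. W v * vertex_operator G len \<alpha> U v) =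
     (\<Sum>e\<in>arcs G. (W (head G e) - W (tail G e)) * (U (head G e) - U (tail G e)) / len e) +
     (\<Sum>v\<in>verts G. \<alpha> v * W v * U v)"
proof -
  have "(\<Sum>v\<in>verts G. W v * vertex_operator G len \<alpha> U v) =
     (\<Sum>v\<in>verts G. \<Sum>e\<in>arcs G. incidence G e v * W v * ((U (head G e) - U (tail G e)) / len e)) +
     (\<Sum>v\<in>verts G. \<alpha> v * W v * U v)"
    by (simp add: vertex_operator_def distrib_left sum.distrib sum_distrib_left mult_ac)
  also have "(\<Sum>v\<in>verts G. \<Sum>e\<in>arcs G. incidence G e v * W v * ((U (head G e) - U (tail G e)) / len e))
     = (\<Sum>e\<in>arcs G. (\<Sum>v\<in>verts G. incidence G e v * W v) * ((U (head G e) - U (tail G e)) / len e))"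
    by (subst sum.swap) (simp only: sum_distrib_right)
  also have "\<dots> = (\<Sum>e\<in>arcs G. (W (head G e) - W (tail G e)) * (U (head G e) - U (tail G e)) / len e)"
    by (intro sum.cong) (simp_all add: sum_incidence)
  finally show ?thesis .
qed

text \<open>The right side is the trapezoidal rule, that is, the integral of the edgewise linear
  interpolant of \<open>W\<close>.\<close>

lemma sum_vertex_mass:
  "(\<Sum>v\<in>verts G. W v * vertex_mass G len v)
     = (\<Sum>e\<in>arcs G. (W (head G e) + W (tail G e)) * (len e / 2))"
proof -
  have *: "(\<Sum>v\<in>verts G. of_bool (w = v) * W v) = W w" if "w \<in> verts G" for w
    using that by (simp add: of_bool_def if_distribR if_distrib cong: if_cong)
  have "(\<Sum>v\<in>verts G. W v * vertex_mass G len v) =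
    (\<Sum>v\<in>verts G. \<Sum>e\<in>arcs G.
       (of_bool (head G e = v) * W v + of_bool (tail G e = v) * W v) * (len e / 2))"
    by (simp add: vertex_mass_def sum_distrib_left algebra_simps)
  also have "\<dots> = (\<Sum>e\<in>arcs G. ((\<Sum>v\<in>verts G. of_bool (head G e = v) * W v) +
       (\<Sum>v\<in>verts G. of_bool (tail G e = v) * W v)) * (len e / 2))"
    by (subst sum.swap) (simp only: sum_distrib_right[symmetric] sum.distrib[symmetric])
  also have "\<dots> = (\<Sum>e\<in>arcs G. (W (head G e) + W (tail G e)) * (len e / 2))"
    by (intro sum.cong) (simp_all add: *)
  finally show ?thesis .
qed

text \<open>The inward-pointing derivatives are \<open>?s e - len e / 2\<close> at the head and
  \<open>- (?s e + len e / 2)\<close> at the tail: the slopes add up to the graph Laplacian, the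
  half lengths to the mass.\<close>

lemma normal_deriv_sum_profile:
  assumes "\<And>e x. e \<in> arcs G \<Longrightarrow> x \<in> {0..len e} \<Longrightarrow> u (glue G len e x) = edge_profile G len U e x"
    and "u (Inl v) = U v"
  shows "normal_deriv_sum G len u v + \<alpha> v * u (Inl v)
           = vertex_operator G len \<alpha> U v - vertex_mass G len v"
proof -
  let ?s = "\<lambda>e. (U (head G e) - U (tail G e)) / len e"
  have deriv: "edge_deriv G len u e x = ?s e + len e / 2 - x" if "e \<in> arcs G" "x \<in> {0..len e}" for e x
    unfolding edge_deriv_def
    using that length_pos[of e] has_derivative_quadratic_on[of "len e" "\<lambda>x. u (glue G len e x)"
        "U (tail G e)" "?s e + len e / 2" x]
    by (intro vector_derivative_within_closed_interval)
      (auto simp: assms(1) edge_profile_def has_real_derivative_iff_has_vector_derivative)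
  have "normal_deriv_sum G len u v =
     (\<Sum>e\<in>in_arcs G v. ?s e - len e / 2) + (\<Sum>e\<in>out_arcs G v. - (?s e + len e / 2))"
    unfolding normal_deriv_sum_def
    using length_pos by (intro arg_cong2[where f = "(+)"] sum.cong refl)
      (auto simp: deriv in_arcs_def out_arcs_def less_imp_le)
  \<comment> \<open>Indicator sums over all arcs allow merging the two sums while a loop still
    contributes both of its ends.\<close>
  also have "\<dots> = (\<Sum>e\<in>arcs G. of_bool (head G e = v) * (?s e - len e / 2)) +
     (\<Sum>e\<in>arcs G. of_bool (tail G e = v) * - (?s e + len e / 2))"
    unfolding in_arcs_def out_arcs_def
    by (intro arg_cong2[where f = "(+)"]; intro sum.mono_neutral_cong_left) auto
  also have "\<dots> = (\<Sum>e\<in>arcs G. incidence G e v * ?s e) - vertex_mass G len v"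
    unfolding vertex_mass_def sum_subtractf[symmetric] sum.distrib[symmetric] incidence_def
    by (intro sum.cong) (auto simp: algebra_simps)
  finally show ?thesis
    by (simp add: vertex_operator_def assms(2))
qed

lemma solution_profile:
  assumes "neg_laplacian_eq G len \<alpha> u (\<lambda>_. 1)" "e \<in> arcs G" "x \<in> {0..len e}"
  shows "u (glue G len e x) = edge_profile G len (\<lambda>v. u (Inl v)) e x"
  using H2_second_deriv_minus_one_imp[of "len e" "\<lambda>x. u (glue G len e x)" x] assms length_pos[of e]
  by (simp add: neg_laplacian_eq_def edge_profile_def glue_head)

text \<open>This direction yields uniqueness of the torsion function; the converse
  \<open>extend_solution\<close> yields existence.\<close>

lemma solution_nodal:
  assumes "neg_laplacian_eq G len \<alpha> u (\<lambda>_. 1)"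
  shows "nodal_solution G len \<alpha> (\<lambda>v. u (Inl v))"
  unfolding nodal_solution_def
proof
  fix v assume "v \<in> verts G"
  then have "normal_deriv_sum G len u v + \<alpha> v * u (Inl v) = 0"
    using assms by (simp add: neg_laplacian_eq_def delta_domain_def)
  then show "vertex_operator G len \<alpha> (\<lambda>v. u (Inl v)) v = vertex_mass G len v"
    using normal_deriv_sum_profile[of u "\<lambda>v. u (Inl v)" v \<alpha>] solution_profile[OF assms] by simp
qed

lemma extend_glue:
  assumes "e \<in> arcs G" "x \<in> {0..len e}"
  shows "extend_from_vertices G len U (glue G len e x) = edge_profile G len U e x"
proof -
  have "glue G len e x \<in> mg_points G len"
    using assms by (auto simp: glue_def mg_points_def)
  then show ?thesis
    using assms length_pos[of e]
    by (auto simp: extend_from_vertices_def glue_def edge_profile_def field_simps power2_eq_square)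
qed

lemma extend_vertex: "v \<in> verts G \<Longrightarrow> extend_from_vertices G len U (Inl v) = U v"
  by (simp add: extend_from_vertices_def mg_points_def)

text \<open>The universal property of the quotient topology: the preimage of an open set is tested
  edge by edge.\<close>

lemma continuous_map_mg:
  assumes "\<And>e. e \<in> arcs G \<Longrightarrow> continuous_on {0..len e} (\<lambda>x. u (glue G len e x))"
  shows "continuous_map (mg_topology G len) euclideanreal u"
  unfolding continuous_map_def topspace_mg_topology
proof (intro conjI allI impI)
  fix S :: "real set" assume S: "openin euclideanreal S"
  show "openin (mg_topology G len) {p \<in> mg_points G len. u p \<in> S}"
    unfolding openin_mg_topology
  proof (intro conjI ballI)
    fix e assume e: "e \<in> arcs G"
    have "{x \<in> {0..len e}. glue G len e x \<in> {p \<in> mg_points G len. u p \<in> S}}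
        = {0..len e} \<inter> (\<lambda>x. u (glue G len e x)) -` S"
      using e by (auto simp: glue_def mg_points_def)
    then show "openin (top_of_set {0..len e})
        {x \<in> {0..len e}. glue G len e x \<in> {p \<in> mg_points G len. u p \<in> S}}"
      using continuous_openin_preimage_gen[OF assms[OF e]] S by simp
  qed auto
qed simp

lemma extend_solution:
  assumes "nodal_solution G len \<alpha> U"
  shows "neg_laplacian_eq G len \<alpha> (extend_from_vertices G len U) (\<lambda>_. 1)"
proof -
  let ?u = "extend_from_vertices G len U"
  have H2: "H2_second_deriv (len e) (\<lambda>x. ?u (glue G len e x)) (\<lambda>_. - 1)" if "e \<in> arcs G" for e
    by (rule H2_second_deriv_quadratic) (simp add: extend_glue that edge_profile_def)
  have cont: "continuous_on {0..len e} (\<lambda>x. ?u (glue G len e x))" if "e \<in> arcs G" for e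
  proof -
    have "continuous_on {0..len e} (edge_profile G len U e)"
      unfolding edge_profile_def by (intro continuous_intros) auto
    then show ?thesis
      by (rule continuous_on_cong[THEN iffD1, rotated 2]) (simp_all add: extend_glue that)
  qed
  have "normal_deriv_sum G len ?u v + \<alpha> v * ?u (Inl v) = 0" if "v \<in> verts G" for v
    using normal_deriv_sum_profile[of ?u U v \<alpha>] assms that
    by (simp add: extend_glue extend_vertex nodal_solution_def)
  moreover have "?u \<in> extensional (mg_points G len)"
    by (simp add: extend_from_vertices_def)
  ultimately have "?u \<in> delta_domain G len \<alpha>"
    using H2 continuous_map_mg[OF cont] by (auto simp: delta_domain_def in_H2_def)
  then show ?thesis
    using H2 by (simp add: neg_laplacian_eq_def)
qed

section \<open>The torsion function of a connected graph\<close>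

text \<open>Extended by the tail value along each edge, \<open>U\<close> is locally constant, so a
  level set and its complement would disconnect the graph.\<close>

lemma connected_constant:
  assumes conn: "mg_connected G len"
    and U: "\<And>e. e \<in> arcs G \<Longrightarrow> U (head G e) = U (tail G e)"
    and v: "v \<in> verts G" and w: "w \<in> verts G"
  shows "U v = U w"
proof (rule ccontr)
  assume neq: "U v \<noteq> U w"
  \<comment> \<open>A general predicate \<open>P\<close> treats the level set and its complement at
    once.\<close>
  define piece where "piece P = {p \<in> mg_points G len. P (case_sum U (\<lambda>(e, x). U (tail G e)) p)}" for P
  have glue: "glue G len e x \<in> piece P \<longleftrightarrow> P (U (tail G e))" if "e \<in> arcs G" "x \<in> {0..len e}" for e x P
    using that U[of e] by (auto simp: piece_def glue_def mg_points_def)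
  have "openin (mg_topology G len) (piece P)" for P
    unfolding openin_mg_topology
  proof (intro conjI ballI)
    fix e assume "e \<in> arcs G"
    then have "{x \<in> {0..len e}. glue G len e x \<in> piece P} = (if P (U (tail G e)) then {0..len e} else {})"
      using glue by auto
    then show "openin (top_of_set {0..len e}) {x \<in> {0..len e}. glue G len e x \<in> piece P}"
      by simp
  qed (auto simp: piece_def)
  moreover have "connected_space (mg_topology G len)"
    using conn by (simp add: mg_connected_def path_connected_imp_connected_space)
  moreover have "topspace (mg_topology G len) \<subseteq> piece (\<lambda>c. c = U v) \<union> piece (\<lambda>c. c \<noteq> U v)"
    by (auto simp: piece_def topspace_mg_topology)
  moreover have "piece (\<lambda>c. c = U v) \<inter> piece (\<lambda>c. c \<noteq> U v) = {}"
    by (auto simp: piece_def)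
  moreover have "Inl v \<in> piece (\<lambda>c. c = U v)" "Inl w \<in> piece (\<lambda>c. c \<noteq> U v)"
    using v w neq by (auto simp: piece_def mg_points_def)
  ultimately show False
    unfolding connected_space_def by blast
qed

end

text \<open>Edge energy and potential energy are both nonnegative, so both vanish. The first makes
  \<open>U\<close> constant by connectedness; a vertex of nonzero strength makes the constant
  0.\<close>

lemma vertex_form_definite:
  assumes adm: "admissible G len \<alpha>"
    and form: "(\<Sum>v\<in>verts G. U v * vertex_operator G len \<alpha> U v) = 0"
    and v: "v \<in> verts G"
  shows "U v = 0"
proof -
  interpret metric_graph G len
    using adm by (simp add: admissible_def)
  have \<alpha>: "\<And>v. v \<in> verts G \<Longrightarrow> 0 \<le> \<alpha> v"
    using adm by (simp add: admissible_def)
  let ?E = "\<Sum>e\<in>arcs G. (U (head G e) - U (tail G e))\<^sup>2 / len e"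
  let ?A = "\<Sum>v\<in>verts G. \<alpha> v * (U v)\<^sup>2"
  have "?E + ?A = 0"
    using form unfolding green by (simp add: power2_eq_square mult.assoc)
  moreover have nonneg: "0 \<le> ?E" "0 \<le> ?A"
    using \<alpha> length_pos by (auto intro!: sum_nonneg simp: less_imp_le)
  ultimately have "?E = 0" "?A = 0"
    by linarith+
  then have E: "\<And>e. e \<in> arcs G \<Longrightarrow> (U (head G e) - U (tail G e))\<^sup>2 / len e = 0"
    and A: "\<And>v. v \<in> verts G \<Longrightarrow> \<alpha> v * (U v)\<^sup>2 = 0"
    using \<alpha> length_pos by (auto simp: sum_nonneg_eq_0_iff less_imp_le)
  obtain w where w: "w \<in> verts G" "\<alpha> w \<noteq> 0"
    using adm by (auto simp: admissible_def)
  have "U v = U w"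
  proof (rule connected_constant[OF _ _ v w(1)])
    show "U (head G e) = U (tail G e)" if "e \<in> arcs G" for e
      using E[OF that] length_pos[OF that] by simp
  qed (use adm in \<open>simp add: admissible_def\<close>)
  then show ?thesis
    using A[OF w(1)] w(2) by simp
qed

lemma nodal_solution_exists:
  assumes adm: "admissible G len \<alpha>"
  shows "\<exists>U. nodal_solution G len \<alpha> U"
proof -
  interpret metric_graph G len
    using adm by (simp add: admissible_def)
  \<comment> \<open>The matrix of \<open>vertex_operator\<close>: incidence matrix times
    conductances times its transpose, plus the diagonal of strengths.\<close>
  define a where "a v w = (\<Sum>e\<in>arcs G. incidence G e v * incidence G e w / len e) +
      \<alpha> v * of_bool (v = w)" for v w
  have a: "(\<Sum>w\<in>verts G. a v w * U w) = vertex_operator G len \<alpha> U v" if "v \<in> verts G" for U v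
  proof -
    have "(\<Sum>w\<in>verts G. a v w * U w) =
        (\<Sum>w\<in>verts G. \<Sum>e\<in>arcs G. incidence G e v / len e * (incidence G e w * U w)) +
        (\<Sum>w\<in>verts G. \<alpha> v * of_bool (v = w) * U w)"
      unfolding sum.distrib[symmetric] a_def
      by (intro sum.cong refl) (simp add: distrib_left distrib_right sum_distrib_left sum_distrib_right mult_ac)
    also have "(\<Sum>w\<in>verts G. \<alpha> v * of_bool (v = w) * U w) = \<alpha> v * U v"
      using that by (simp add: of_bool_def if_distribR if_distrib cong: if_cong)
    also have "(\<Sum>w\<in>verts G. \<Sum>e\<in>arcs G. incidence G e v / len e * (incidence G e w * U w))
        = (\<Sum>e\<in>arcs G. incidence G e v * ((U (head G e) - U (tail G e)) / len e))"
      by (subst sum.swap, unfold sum_distrib_left[symmetric]) (simp add: sum_incidence)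
    finally show ?thesis
      by (simp add: vertex_operator_def)
  qed
  have "\<exists>U. \<forall>v\<in>verts G. (\<Sum>w\<in>verts G. a v w * U w) = vertex_mass G len v"
  proof (rule definite_system_solvable)
    fix U assume "(\<Sum>v\<in>verts G. U v * (\<Sum>w\<in>verts G. a v w * U w)) = 0"
    then show "\<forall>v\<in>verts G. U v = 0"
      using vertex_form_definite[OF adm] by (simp add: a)
  qed simp
  then show ?thesis
    by (auto simp: nodal_solution_def a)
qed

text \<open>The difference solves the homogeneous equation, so the definite form vanishes on
  it.\<close>

lemma nodal_solution_unique:
  assumes adm: "admissible G len \<alpha>" and "nodal_solution G len \<alpha> U" "nodal_solution G len \<alpha> W"
    and "v \<in> verts G"
  shows "U v = W v"
proof -
  have "vertex_operator G len \<alpha> (\<lambda>v. U v - W v) v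
      = vertex_operator G len \<alpha> U v - vertex_operator G len \<alpha> W v" for v
    by (simp add: vertex_operator_def sum_subtractf sum.distrib diff_divide_distrib
        add_divide_distrib right_diff_distrib distrib_left)
  then have "(\<Sum>v\<in>verts G. (U v - W v) * vertex_operator G len \<alpha> (\<lambda>v. U v - W v) v) = 0"
    using assms by (intro sum.neutral) (simp add: nodal_solution_def)
  from vertex_form_definite[OF adm this \<open>v \<in> verts G\<close>] show ?thesis
    by simp
qed

text \<open>Any solution has the same vertex values, hence the same edge profiles; extensionality
  settles the points off the graph.\<close>

lemma torsion_function_eq:
  assumes adm: "admissible G len \<alpha>" and U: "nodal_solution G len \<alpha> U"
  shows "torsion_function G len \<alpha> = extend_from_vertices G len U"
proof -
  interpret metric_graph G len
    using adm by (simp add: admissible_def)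
  let ?u = "extend_from_vertices G len U"
  have "w = ?u" if w: "neg_laplacian_eq G len \<alpha> w (\<lambda>_. 1)" for w
  proof (rule extensionalityI)
    show "w \<in> extensional (mg_points G len)"
      using w by (simp add: neg_laplacian_eq_def delta_domain_def)
    show "?u \<in> extensional (mg_points G len)"
      by (simp add: extend_from_vertices_def)
    have vert: "w (Inl v) = U v" if "v \<in> verts G" for v
      using nodal_solution_unique[OF adm solution_nodal[OF w] U that] .
    fix p assume p: "p \<in> mg_points G len"
    show "w p = ?u p"
    proof (cases p)
      case (Inl v)
      then show ?thesis
        using p vert[of v] by (auto simp: extend_vertex mg_points_def)
    next
      case (Inr ex)
      then obtain e x where ex: "p = Inr (e, x)" "e \<in> arcs G" "0 < x" "x < len e"
        using p by (auto simp: mg_points_def)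
      then have "p = glue G len e x"
        by (simp add: glue_def)
      then show ?thesis
        using ex solution_profile[OF w, of e x] by (simp add: extend_glue edge_profile_def vert)
    qed
  qed
  then show ?thesis
    unfolding torsion_function_def using extend_solution[OF U] by (intro the_equality)
qed

section \<open>Rigidity formula and lower bound\<close>

lemma torsional_rigidity_eq:
  assumes adm: "admissible G len \<alpha>" and U: "nodal_solution G len \<alpha> U"
  shows "torsional_rigidity G len \<alpha>
           = (\<Sum>e\<in>arcs G. len e ^ 3) / 12 + (\<Sum>v\<in>verts G. U v * vertex_mass G len v)"
proof -
  interpret metric_graph G len
    using adm by (simp add: admissible_def)
  \<comment> \<open>The term \<open>len e ^ 3 / 12\<close> is the rigidity of the Dirichlet
    interval; the other is the trapezoid under the linear interpolant.\<close>
  have "(LINT x|lebesgue_on {0..len e}. extend_from_vertices G len U (glue G len e x))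
      = len e ^ 3 / 12 + (U (head G e) + U (tail G e)) * (len e / 2)" if e: "e \<in> arcs G" for e
  proof -
    have "(LINT x|lebesgue_on {0..len e}. extend_from_vertices G len U (glue G len e x))
      = U (tail G e) * len e +
        ((U (head G e) - U (tail G e)) / len e + len e / 2) * (len e)\<^sup>2 / 2 - len e ^ 3 / 6"
      using length_pos[OF e]
      by (intro integral_quadratic) (simp_all add: extend_glue[OF e] edge_profile_def)
    also have "\<dots> = len e ^ 3 / 12 + (U (head G e) + U (tail G e)) * (len e / 2)"
      using length_pos[OF e] by (simp add: field_simps power2_eq_square power3_eq_cube)
    finally show ?thesis .
  qed
  then have "torsional_rigidity G len \<alpha>
      = (\<Sum>e\<in>arcs G. len e ^ 3 / 12 + (U (head G e) + U (tail G e)) * (len e / 2))"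
    unfolding torsional_rigidity_def torsion_function_eq[OF adm U] mg_integral_def by simp
  then show ?thesis
    by (simp add: sum.distrib sum_divide_distrib sum_vertex_mass)
qed

lemma torsional_rigidity_ge:
  assumes adm: "admissible G len \<alpha>"
  shows "total_length G len ^ 3 / (12 * real (card (arcs G)) ^ 2)
           + total_length G len ^ 2 / total_strength G \<alpha> \<le> torsional_rigidity G len \<alpha>"
proof -
  interpret metric_graph G len
    using adm by (simp add: admissible_def)
  obtain U where U: "nodal_solution G len \<alpha> U"
    using nodal_solution_exists[OF adm] by blast
  have test: "(\<Sum>v\<in>verts G. W v * vertex_operator G len \<alpha> U v)
      = (\<Sum>v\<in>verts G. W v * vertex_mass G len v)" for W
    using U by (simp add: nodal_solution_def)
  have "(\<Sum>v\<in>verts G. \<alpha> v * U v) = total_length G len"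
    using test[of "\<lambda>_. 1"] unfolding green sum_vertex_mass by (simp add: total_length_def)
  then have "total_length G len ^ 2 / total_strength G \<alpha> \<le> (\<Sum>v\<in>verts G. \<alpha> v * (U v)\<^sup>2)"
    using weighted_square_sum_ge[of "verts G" \<alpha> U] adm
    by (simp add: total_strength_def admissible_def)
  \<comment> \<open>The added edge energy is zero exactly when \<open>U\<close> agrees at the two
    ends of every edge, as on a flower.\<close>
  also have "\<dots> \<le> (\<Sum>e\<in>arcs G. (U (head G e) - U (tail G e))\<^sup>2 / len e) + (\<Sum>v\<in>verts G. \<alpha> v * (U v)\<^sup>2)"
    using length_pos by (auto intro!: sum_nonneg simp: less_imp_le)
  also have "\<dots> = (\<Sum>v\<in>verts G. U v * vertex_mass G len v)"
    using test[of U] unfolding green by (simp add: power2_eq_square mult.assoc)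
  finally have "total_length G len ^ 2 / total_strength G \<alpha> \<le> (\<Sum>v\<in>verts G. U v * vertex_mass G len v)" .
  moreover have "total_length G len ^ 3 / (12 * real (card (arcs G)) ^ 2) \<le> (\<Sum>e\<in>arcs G. len e ^ 3) / 12"
    using sum_cubes_ge[of "arcs G" len] length_pos
    by (simp add: total_length_def less_imp_le field_simps)
  ultimately show ?thesis
    unfolding torsional_rigidity_eq[OF adm U] by linarith
qed

section \<open>Flower graphs\<close>

text \<open>Every interior point is joined to the vertex by a segment of its loop; paths between two
  points pass through the vertex.\<close>

lemma (in metric_graph) single_vertex_connected:
  assumes "verts G = {v}"
  shows "mg_connected G len"
proof -
  have end_points: "tail G e = v" "head G e = v" if "e \<in> arcs G" for e
    using that tail_in_verts[of e] head_in_verts[of e] assms by auto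
  have cont: "continuous_map (top_of_set {0..len e}) (mg_topology G len) (glue G len e)"
    if e: "e \<in> arcs G" for e
    using e by (auto simp: continuous_map_def topspace_mg_topology openin_mg_topology
        glue_def mg_points_def)
  have joined: "path_component_of (mg_topology G len) (Inl v) p" if p: "p \<in> mg_points G len" for p
  proof (cases p)
    case (Inl w)
    then show ?thesis
      using p assms by (auto simp: path_component_of_refl topspace_mg_topology mg_points_def)
  next
    case (Inr ex)
    then obtain e x where ex: "p = Inr (e, x)" "e \<in> arcs G" "0 < x" "x < len e"
      using p by (auto simp: mg_points_def)
    let ?g = "\<lambda>t. t * x"
    have "0 \<le> ?g t \<and> ?g t \<le> len e" if "0 \<le> t" "t \<le> 1" for t
      using order_trans[OF mult_left_le_one_le[of x t], of "len e"] that ex by auto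
    then have "pathin (top_of_set {0..len e}) ?g"
      by (auto simp: pathin_def intro!: continuous_intros)
    then have "pathin (mg_topology G len) (glue G len e \<circ> ?g)"
      using cont[OF ex(2)] by (simp add: pathin_compose)
    moreover have "(glue G len e \<circ> ?g) 0 = Inl v" "(glue G len e \<circ> ?g) 1 = p"
      using ex end_points by (auto simp: glue_def)
    ultimately show ?thesis
      unfolding path_component_of_def by blast
  qed
  show ?thesis
    unfolding mg_connected_def path_connected_space_iff_path_component topspace_mg_topology
    using joined by (meson path_component_of_sym path_component_of_trans)
qed

lemma equilateral_flower:
  fixes L s :: real and n :: nat
  assumes "0 < L" "1 \<le> n" "0 < s"
  defines "F \<equiv> \<lparr>verts = {0 :: nat}, arcs = {..<n}, tail = \<lambda>_. 0, head = \<lambda>_. 0\<rparr>"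
  shows "flower_graph F (\<lambda>_. L / n)" "admissible_with L n s F (\<lambda>_. L / n) (\<lambda>_. s)"
    "torsional_rigidity F (\<lambda>_. L / n) (\<lambda>_. s) = L ^ 3 / (12 * real n ^ 2) + L ^ 2 / s"
proof -
  interpret metric_graph F "\<lambda>_. L / n"
    by unfold_locales (use assms in auto)
  show "flower_graph F (\<lambda>_. L / n)"
    using metric_graph_axioms by (auto simp: flower_graph_def F_def)
  have adm: "admissible F (\<lambda>_. L / n) (\<lambda>_. s)"
    using metric_graph_axioms single_vertex_connected[of 0] assms
    by (auto simp: admissible_def F_def)
  then show "admissible_with L n s F (\<lambda>_. L / n) (\<lambda>_. s)"
    using assms by (simp add: admissible_with_def total_length_def total_strength_def F_def)
  have mass: "vertex_mass F (\<lambda>_. L / n) 0 = L"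
    using assms by (simp add: vertex_mass_def F_def)
  \<comment> \<open>Loops carry no edge term, so the nodal equation at the only vertex reads
    \<open>s * U = L\<close>.\<close>
  have "nodal_solution F (\<lambda>_. L / n) (\<lambda>_. s) (\<lambda>_. L / s)"
    using mass assms by (simp add: nodal_solution_def vertex_operator_def F_def)
  from torsional_rigidity_eq[OF adm this]
  have "torsional_rigidity F (\<lambda>_. L / n) (\<lambda>_. s) = n * (L / n) ^ 3 / 12 + L / s * L"
    using mass by (simp add: F_def)
  then show "torsional_rigidity F (\<lambda>_. L / n) (\<lambda>_. s) = L ^ 3 / (12 * real n ^ 2) + L ^ 2 / s"
    using assms(2) by (simp add: field_simps power2_eq_square power3_eq_cube)
qed

text \<open>The minimizer has its own vertex and edge type \<open>nat\<close>, so it exists for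
  every \<open>n\<close> even if \<open>'e\<close> is a finite type.\<close>

theorem theorem8p1:
  shows
    "(\<forall>(G :: ('v, 'e) pre_digraph) len \<alpha>. admissible G len \<alpha> \<longrightarrow>
        torsional_rigidity G len \<alpha>
          \<ge> total_length G len ^ 3 / (12 * real (card (arcs G)) ^ 2)
            + total_length G len ^ 2 / total_strength G \<alpha>) \<and>
     (\<forall>L > 0. \<forall>n \<ge> 1. \<forall>s > 0.
        \<exists>(F :: (nat, nat) pre_digraph) \<kappa> \<beta>.
          flower_graph F \<kappa> \<and> admissible_with L n s F \<kappa> \<beta> \<and>
          torsional_rigidity F \<kappa> \<beta> = L ^ 3 / (12 * real n ^ 2) + L ^ 2 / s \<and>
          (\<forall>(G :: ('v, 'e) pre_digraph) len \<alpha>. admissible_with L n s G len \<alpha> \<longrightarrow>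
             torsional_rigidity F \<kappa> \<beta> \<le> torsional_rigidity G len \<alpha>))"
proof (intro conjI allI impI)
  fix L s :: real and n :: nat
  assume "0 < L" "1 \<le> n" "0 < s"
  note flower = equilateral_flower[OF this]
  \<comment> \<open>The lower bound depends on \<open>L\<close>, \<open>n\<close> and
    \<open>s\<close> only, and the equilateral flower attains it.\<close>
  have "L ^ 3 / (12 * real n ^ 2) + L ^ 2 / s \<le> torsional_rigidity G len \<alpha>"
    if "admissible_with L n s G len \<alpha>" for G :: "('v, 'e) pre_digraph" and len \<alpha>
    using torsional_rigidity_ge[of G len \<alpha>] that by (simp add: admissible_with_def)
  with flower show "\<exists>(F :: (nat, nat) pre_digraph) \<kappa> \<beta>.
          flower_graph F \<kappa> \<and> admissible_with L n s F \<kappa> \<beta> \<and>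
          torsional_rigidity F \<kappa> \<beta> = L ^ 3 / (12 * real n ^ 2) + L ^ 2 / s \<and>
          (\<forall>(G :: ('v, 'e) pre_digraph) len \<alpha>. admissible_with L n s G len \<alpha> \<longrightarrow>
             torsional_rigidity F \<kappa> \<beta> \<le> torsional_rigidity G len \<alpha>)"
    by (intro exI conjI allI impI) (assumption | simp)+
qed (rule torsional_rigidity_ge)

end
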